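(* Let $\mathcal{X}$ be a separable real Banach space and $h:\mathcal{X}\rightarrow\mathbb{R}$ be any convex function which is globally Lipschitz continuous. Suppose that the set $$\mathcal{Y}:=\{x\in\mathcal{X}: h\text{ has a unique Fenchel subgradient }\mathrm{d}h_x\in\mathcal{X}^{\ast}\text{ at }x\}$$ is dense in $\mathcal{X}$. Then, for any $x\in\mathcal{X}$, the Fenchel subdifferential $\partial h(x)$ of $h$ at $x$ is the weak$^{\ast}$-closed convex hull of the set $\mathcal{Z}_x$. Here, at fixed $x\in\mathcal{X}$, $\mathcal{Z}_x$ is the set of functionals $x^{\ast}\in\mathcal{X}^{\ast}$ such that there is a net $\{x_i\}_{i\in I}$ in $\mathcal{Y}$ converging to $x$ with the property that the unique Fenchel subgradient $\mathrm{d}h_{x_i}\in\mathcal{X}^{\ast}$ of $h$ at $x_i$ converges towards $x^{\ast}$ in the weak$^{\ast}$-topology.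
   Context: $\mathcal{X}^{\ast}$ is the space of continuous linear functionals $\mathcal{X}\to\mathbb{R}$. A functional $\ell\in\mathcal{X}^{\ast}$ is a Fenchel subgradient of $h:\mathcal{X}\to(-\infty,\infty]$ at $x\in\mathcal{X}$ iff $h(x+x')\geq h(x)+\ell(x')$ for all $x'\in\mathcal{X}$. The Fenchel subdifferential $\partial h(x)\subset\mathcal{X}^{\ast}$ is the set of all Fenchel subgradients of $h$ at $x$. Density in $\mathcal{X}$ and convergence of $\{x_i\}_{i\in I}$ to $x$ are with respect to the norm topology of $\mathcal{X}$. *)

theory Defs
  imports "HOL-Analysis.Analysis"
begin

definition fenchel_subgradient ::
    "('a::real_normed_vector \<Rightarrow> real) \<Rightarrow> 'a \<Rightarrow> ('a \<Rightarrow>\<^sub>L real) \<Rightarrow> bool" where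
  "fenchel_subgradient h x l \<longleftrightarrow> (\<forall>x'. h (x + x') \<ge> h x + blinfun_apply l x')"

definition fenchel_subdifferential ::
    "('a::real_normed_vector \<Rightarrow> real) \<Rightarrow> 'a \<Rightarrow> ('a \<Rightarrow>\<^sub>L real) set" where
  "fenchel_subdifferential h x = {l. fenchel_subgradient h x l}"

definition unique_subgradient_points :: "('a::real_normed_vector \<Rightarrow> real) \<Rightarrow> 'a set" where
  "unique_subgradient_points h = {x. \<exists>!l. fenchel_subgradient h x l}"

text \<open>Only meaningful at points of \<open>unique_subgradient_points h\<close>.\<close>

definition the_subgradient :: "('a::real_normed_vector \<Rightarrow> real) \<Rightarrow> 'a \<Rightarrow> ('a \<Rightarrow>\<^sub>L real)" where
  "the_subgradient h x = (THE l. fenchel_subgradient h x l)"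

text \<open>For real-valued operators the strong operator topology is the topology of pointwise
  convergence on the dual space, i.e. the weak* topology.\<close>

abbreviation weak_star_topology :: "('a::real_normed_vector \<Rightarrow>\<^sub>L real) topology" where
  "weak_star_topology \<equiv> strong_operator_topology"

text \<open>Here \<open>(i, j) \<in> r\<close> means that \<open>j\<close> is at or beyond \<open>i\<close>.\<close>

definition directed_set :: "'i set \<Rightarrow> 'i rel \<Rightarrow> bool" where
  "directed_set I r \<longleftrightarrow> I \<noteq> {} \<and> preorder_on I r \<and>
     (\<forall>i\<in>I. \<forall>j\<in>I. \<exists>k\<in>I. (i, k) \<in> r \<and> (j, k) \<in> r)"

text \<open>The filter of tails of a directed set: a net indexed by \<open>I\<close> converges iff it converges
  along this filter.\<close>

definition tails_filter :: "'i set \<Rightarrow> 'i rel \<Rightarrow> 'i filter" where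
  "tails_filter I r = (INF i\<in>I. principal {j\<in>I. (i, j) \<in> r})"

lemma eventually_tails_filter:
  assumes "directed_set I r"
  shows "eventually P (tails_filter I r) \<longleftrightarrow> (\<exists>i\<in>I. \<forall>j\<in>I. (i, j) \<in> r \<longrightarrow> P j)"
proof -
  have tr: "trans r" and ne: "I \<noteq> {}"
    using assms by (auto simp: directed_set_def preorder_on_def)
  have "\<exists>k\<in>I. principal {l\<in>I. (k, l) \<in> r}
          \<le> inf (principal {l\<in>I. (i, l) \<in> r}) (principal {l\<in>I. (j, l) \<in> r})"
    if ij: "i \<in> I" "j \<in> I" for i j
  proof -
    obtain k where "k \<in> I" "(i, k) \<in> r" "(j, k) \<in> r"
      using assms ij by (auto simp: directed_set_def)
    then show ?thesis
      using tr by (intro bexI[of _ k]) (auto dest: transD)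
  qed
  then show ?thesis
    unfolding tails_filter_def using ne
    by (subst eventually_INF_base) (auto simp: eventually_principal)
qed

definition net_of_subgradients ::
    "('a::real_normed_vector \<Rightarrow> real) \<Rightarrow> 'a \<Rightarrow> ('a \<Rightarrow>\<^sub>L real) \<Rightarrow> 'i set \<Rightarrow> 'i rel \<Rightarrow> ('i \<Rightarrow> 'a) \<Rightarrow> bool"
  where
  "net_of_subgradients h x xs I r s \<longleftrightarrow>
     directed_set I r \<and>
     (\<forall>i\<in>I. s i \<in> unique_subgradient_points h) \<and>
     (s \<longlongrightarrow> x) (tails_filter I r) \<and>
     limitin weak_star_topology (\<lambda>i. the_subgradient h (s i)) xs (tails_filter I r)"

text \<open>A set in HOL cannot be defined by quantifying over index sets of all types, so the index
  type is fixed to be large enough to hold pairs of neighbourhoods in \<open>'a\<close> and in its dual.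
  Lemma \<open>net_limit_subgradients_any_index\<close> below shows that index sets of other types do not yield
  further limits.\<close>

definition net_limit_subgradients ::
    "('a::real_normed_vector \<Rightarrow> real) \<Rightarrow> 'a \<Rightarrow> ('a \<Rightarrow>\<^sub>L real) set" where
  "net_limit_subgradients h x =
     {xs. \<exists>(I :: ('a set \<times> ('a \<Rightarrow>\<^sub>L real) set) set) r s. net_of_subgradients h x xs I r s}"

lemma net_limit_subgradients_any_index:
  fixes I :: "'i set"
  assumes "net_of_subgradients h x xs I r s"
  shows "xs \<in> net_limit_subgradients h x"
proof -
  let ?Y = "unique_subgradient_points h"
  have dir: "directed_set I r" and Y: "\<And>i. i \<in> I \<Longrightarrow> s i \<in> ?Y"
    and lim: "(s \<longlongrightarrow> x) (tails_filter I r)"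
    and lim': "limitin weak_star_topology (\<lambda>i. the_subgradient h (s i)) xs (tails_filter I r)"
    using assms by (auto simp: net_of_subgradients_def)
  define K where "K = {p. open (fst p) \<and> x \<in> fst p \<and>
    openin weak_star_topology (snd p) \<and> xs \<in> snd p}"
  define q where "q = {(p, p'). p \<in> K \<and> p' \<in> K \<and> fst p' \<subseteq> fst p \<and> snd p' \<subseteq> snd p}"
  have ex: "\<exists>y. y \<in> ?Y \<and> y \<in> fst p \<and> the_subgradient h y \<in> snd p" if "p \<in> K" for p
  proof -
    have "eventually (\<lambda>i. s i \<in> fst p) (tails_filter I r)"
      using lim that by (auto simp: K_def tendsto_def)
    moreover have "eventually (\<lambda>i. the_subgradient h (s i) \<in> snd p) (tails_filter I r)"
      using lim' that by (auto simp: K_def limitin_def)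
    ultimately have "eventually (\<lambda>i. s i \<in> fst p \<and> the_subgradient h (s i) \<in> snd p)
        (tails_filter I r)"
      by (rule eventually_conj)
    then obtain i where "i \<in> I"
      "\<forall>j\<in>I. (i, j) \<in> r \<longrightarrow> s j \<in> fst p \<and> the_subgradient h (s j) \<in> snd p"
      by (auto simp: eventually_tails_filter[OF dir])
    moreover have "(i, i) \<in> r"
      using dir \<open>i \<in> I\<close> by (auto simp: directed_set_def preorder_on_def refl_on_def)
    ultimately show ?thesis using Y by blast
  qed
  define t where "t p = (SOME y. y \<in> ?Y \<and> y \<in> fst p \<and> the_subgradient h y \<in> snd p)" for p
  have t: "t p \<in> ?Y \<and> t p \<in> fst p \<and> the_subgradient h (t p) \<in> snd p" if "p \<in> K" for p
    unfolding t_def by (rule someI_ex[OF ex[OF that]])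
  have xs: "openin weak_star_topology (UNIV :: ('a \<Rightarrow>\<^sub>L real) set)"
    by (metis openin_topspace strong_operator_topology_topspace)
  have UK: "(UNIV, UNIV) \<in> K"
    using xs by (simp add: K_def)
  have dirK: "directed_set K q"
    unfolding directed_set_def
  proof (intro conjI ballI)
    show "K \<noteq> {}" using UK by blast
    show "preorder_on K q"
      by (auto simp: preorder_on_def refl_on_def trans_def q_def)
    fix p p' assume "p \<in> K" "p' \<in> K"
    then show "\<exists>k\<in>K. (p, k) \<in> q \<and> (p', k) \<in> q"
      by (intro bexI[of _ "(fst p \<inter> fst p', snd p \<inter> snd p')"]) (auto simp: K_def q_def)
  qed
  have "(t \<longlongrightarrow> x) (tails_filter K q)"
    unfolding tendsto_def eventually_tails_filter[OF dirK]
  proof (intro allI impI)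
    fix A assume "open A" "x \<in> A"
    then have "(A, UNIV) \<in> K" using xs by (simp add: K_def)
    moreover have "t k \<in> A" if "k \<in> K" "((A, UNIV), k) \<in> q" for k
      using t[OF that(1)] that(2) by (auto simp: q_def)
    ultimately show "\<exists>i\<in>K. \<forall>j\<in>K. (i, j) \<in> q \<longrightarrow> t j \<in> A" by blast
  qed
  moreover have "limitin weak_star_topology (\<lambda>p. the_subgradient h (t p)) xs (tails_filter K q)"
    unfolding limitin_def eventually_tails_filter[OF dirK]
  proof (intro conjI allI impI)
    show "xs \<in> topspace weak_star_topology" by (simp add: strong_operator_topology_topspace)
    fix B assume "openin weak_star_topology B \<and> xs \<in> B"
    then have "(UNIV, B) \<in> K" by (simp add: K_def)
    moreover have "the_subgradient h (t k) \<in> B" if "k \<in> K" "((UNIV, B), k) \<in> q" for k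
      using t[OF that(1)] that(2) by (auto simp: q_def)
    ultimately show "\<exists>i\<in>K. \<forall>j\<in>K. (i, j) \<in> q \<longrightarrow> the_subgradient h (t j) \<in> B" by blast
  qed
  ultimately have "net_of_subgradients h x xs K q t"
    using dirK t by (auto simp: net_of_subgradients_def)
  then show ?thesis
    unfolding net_limit_subgradients_def by blast
qed

end

theory Submission
  imports Defs
begin

text \<open>Weak* limits of subgradients are subgradients, so the content is the inclusion of the
  subdifferential in the weak* closed hull. If a subgradient \<open>l\<close> at \<open>x\<close> were outside of it, some
  vector \<open>v\<close> would separate them: \<open>k v < l v\<close> for all \<open>k\<close> in the hull. Approximate \<open>x + t v\<close>, as
  \<open>t\<close> decreases to 0, up to \<open>t\<^sup>2\<close> by points \<open>y\<close> with unique subgradient \<open>d\<close>. The subgradient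
  inequality at \<open>y\<close> in direction \<open>- t v\<close>, the one at \<open>x\<close> in direction \<open>t v\<close> and the Lipschitz bound
  give \<open>d v \<ge> l v - 2 L t\<close>. By separability these subgradients have a weak* convergent subsequence,
  and its limit \<open>k\<close> satisfies \<open>k v \<ge> l v\<close>, a contradiction.\<close>

section \<open>The weak* topology: convergence, basic neighbourhoods, separation\<close>

text \<open>The topology is the pullback of the product topology along \<open>blinfun_apply\<close>,
  and limits in a product are taken coordinate by coordinate.\<close>

lemma limitin_strong_operator_topology:
  fixes l :: "'a::real_normed_vector \<Rightarrow>\<^sub>L 'b::real_normed_vector"
  shows "limitin strong_operator_topology f l F \<longleftrightarrow>
    (\<forall>v. ((\<lambda>i. blinfun_apply (f i) v) \<longlongrightarrow> blinfun_apply l v) F)"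
proof (intro iffI allI)
  fix v
  assume "limitin strong_operator_topology f l F"
  from continuous_map_limit[OF strong_operator_topology_continuous_evaluation this, of v]
  show "((\<lambda>i. blinfun_apply (f i) v) \<longlongrightarrow> blinfun_apply l v) F"
    by (simp add: o_def)
next
  assume "\<forall>v. ((\<lambda>i. blinfun_apply (f i) v) \<longlongrightarrow> blinfun_apply l v) F"
  then have "limitin (product_topology (\<lambda>_. euclidean) UNIV) (\<lambda>i. blinfun_apply (f i))
      (blinfun_apply l) F"
    by (simp add: limitin_componentwise)
  then have "((\<lambda>i. blinfun_apply (f i)) \<longlongrightarrow> blinfun_apply l) F"
    by (simp add: euclidean_product_topology)
  then show "limitin strong_operator_topology f l F"
    by (auto simp: limitin_def strong_operator_topology_def openin_pullback_topology tendsto_def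
        topspace_pullback_topology)
qed

text \<open>A basic open set of the product constrains only finitely many coordinates, so one radius
  serves them all. This turns separation by an open set into a numerical gap at finitely many
  vectors.\<close>

lemma strong_operator_topology_open_contains_basis:
  fixes l :: "'a::real_normed_vector \<Rightarrow>\<^sub>L real"
  assumes "openin strong_operator_topology U" "l \<in> U"
  obtains V e where "finite V" "e > 0"
    "\<And>k. (\<And>v. v \<in> V \<Longrightarrow> \<bar>blinfun_apply k v - blinfun_apply l v\<bar> < e) \<Longrightarrow> k \<in> U"
proof -
  obtain W where W: "open W" "U = blinfun_apply -` W"
    using assms(1) by (auto simp: strong_operator_topology_def openin_pullback_topology)
  have "openin (product_topology (\<lambda>_. euclidean) UNIV) W"
    using W(1) by (simp add: euclidean_product_topology)
  moreover have "blinfun_apply l \<in> W" using W(2) assms(2) by simp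
  ultimately obtain X where X: "finite {i. X i \<noteq> UNIV}" "\<And>i. open (X i)"
      "blinfun_apply l \<in> Pi\<^sub>E UNIV X" "Pi\<^sub>E UNIV X \<subseteq> W"
    unfolding openin_product_topology_alt by fastforce
  define V where "V = {i. X i \<noteq> UNIV}"
  have "\<exists>e>0. ball (blinfun_apply l v) e \<subseteq> X v" for v
    using X(2)[of v] X(3) by (auto simp: open_contains_ball PiE_UNIV_domain)
  then obtain \<epsilon> where \<epsilon>: "\<And>v. \<epsilon> v > 0" "\<And>v. ball (blinfun_apply l v) (\<epsilon> v) \<subseteq> X v"
    by metis
  \<comment> \<open>The 1 keeps the minimum meaningful and positive when \<open>V\<close> is
    empty.\<close>
  define e where "e = Min (insert 1 (\<epsilon> ` V))"
  have fin: "finite V" using X(1) by (simp add: V_def)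
  have e: "e > 0" "\<And>v. v \<in> V \<Longrightarrow> e \<le> \<epsilon> v"
    using fin \<epsilon>(1) by (auto simp: e_def Min_gr_iff)
  show thesis
  proof (rule that[OF fin e(1)])
    fix k assume k: "\<And>v. v \<in> V \<Longrightarrow> \<bar>blinfun_apply k v - blinfun_apply l v\<bar> < e"
    have "blinfun_apply k v \<in> X v" for v
    proof (cases "v \<in> V")
      case True
      then have "blinfun_apply k v \<in> ball (blinfun_apply l v) (\<epsilon> v)"
        using k[OF True] e(2)[OF True] by (simp add: dist_real_def abs_minus_commute)
      then show ?thesis using \<epsilon>(2) by blast
    next
      case False
      then show ?thesis by (simp add: V_def)
    qed
    then have "blinfun_apply k \<in> Pi\<^sub>E UNIV X" by (simp add: PiE_def)
    then show "k \<in> U" using X(4) W(2) by auto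
  qed
qed

text \<open>Minimising the sum of squares \<open>F\<close> below is the Euclidean projection of the image of \<open>l\<close> onto
  the image of \<open>C\<close> under evaluation at finitely many vectors. As the minimum need not be attained,
  the first-order condition is replaced by an estimate at a near-minimiser \<open>k0\<close>.\<close>

lemma weak_star_separation:
  fixes l :: "'a::real_normed_vector \<Rightarrow>\<^sub>L real"
  assumes "convex C" "bounded C" and l: "l \<notin> weak_star_topology closure_of C"
  obtains w where "\<And>k. k \<in> C \<Longrightarrow> blinfun_apply k w < blinfun_apply l w"
proof (cases "C = {}")
  case True
  then show ?thesis using that by blast
next
  case False
  obtain U where U: "openin weak_star_topology U" "l \<in> U" "C \<inter> U = {}"
    using l by (auto simp: in_closure_of strong_operator_topology_topspace)
  obtain V e where V: "finite V" "e > 0"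
    "\<And>k. (\<And>v. v \<in> V \<Longrightarrow> \<bar>blinfun_apply k v - blinfun_apply l v\<bar> < e) \<Longrightarrow> k \<in> U"
    using strong_operator_topology_open_contains_basis[OF U(1,2)] by blast
  obtain R where R: "\<And>k. k \<in> C \<Longrightarrow> norm k \<le> R"
    using \<open>bounded C\<close> by (auto simp: bounded_iff)
  define F where "F k = (\<Sum>v\<in>V. (blinfun_apply k v - blinfun_apply l v)\<^sup>2)" for k
  \<comment> \<open>Since \<open>C\<close> has norm bound \<open>R\<close>, two of its members
    differ at \<open>v\<close> by at most \<open>2 * R * norm v\<close>; thus \<open>M\<close>
    bounds the squared diameter of the image of \<open>C\<close> under evaluation on
    \<open>V\<close>.\<close>
  define M where "M = (\<Sum>v\<in>V. (2 * R * norm v)\<^sup>2)"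
  define m where "m = Inf (F ` C)"
  have F_ge: "F k \<ge> e\<^sup>2" if "k \<in> C" for k
  proof -
    have "k \<notin> U" using U(3) that by blast
    then have "\<not> (\<forall>v\<in>V. \<bar>blinfun_apply k v - blinfun_apply l v\<bar> < e)"
      using V(3) by blast
    then obtain v where v: "v \<in> V" "\<bar>blinfun_apply k v - blinfun_apply l v\<bar> \<ge> e"
      by (auto simp: not_less)
    have "e\<^sup>2 \<le> (blinfun_apply k v - blinfun_apply l v)\<^sup>2"
      using power_mono[OF v(2), of 2] V(2) by simp
    also have "\<dots> \<le> F k"
      unfolding F_def using V(1) v(1) by (intro member_le_sum) auto
    finally show ?thesis .
  qed
  have m_le: "m \<le> F k" if "k \<in> C" for k
    unfolding m_def using that F_ge by (intro cInf_lower) (auto intro!: bdd_belowI)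
  have "e\<^sup>2 \<le> m"
    unfolding m_def using False F_ge by (intro cInf_greatest) auto
  then have m: "m > 0" using V(2) zero_less_power[of e 2] by linarith
  have M: "M \<ge> 0" unfolding M_def by (intro sum_nonneg) auto
  \<comment> \<open>A step length in (0, 1] so short that the quadratic term
    \<open>t\<^sup>2 * M\<close> of the expansion below is at most \<open>t * m\<close>.\<close>
  define t where "t = m / (M + m)"
  have t: "0 < t" "t \<le> 1" "t * M \<le> m"
    using m M by (auto simp: t_def field_simps)
  \<comment> \<open>The slack in near-minimality is chosen after \<open>t\<close> and proportional
    to it, so that it survives division by \<open>t\<close>.\<close>
  have "m < m + t * m / 2" using m t by simp
  moreover have "F ` C \<noteq> {}" using False by simp
  ultimately obtain k0 where k0: "k0 \<in> C" "F k0 < m + t * m / 2"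
    using cInf_lessD[of "F ` C" "m + t * m / 2"] by (auto simp flip: m_def)
  \<comment> \<open>Evaluation at \<open>w\<close> is the inner product with the residual of
    \<open>k0\<close> on \<open>V\<close>, which points from the image of \<open>k0\<close> to that
    of \<open>l\<close>.\<close>
  define w where "w = (\<Sum>v\<in>V. (blinfun_apply l v - blinfun_apply k0 v) *\<^sub>R v)"
  have w: "blinfun_apply k w =
      (\<Sum>v\<in>V. (blinfun_apply l v - blinfun_apply k0 v) * blinfun_apply k v)" for k
    by (simp add: w_def blinfun.sum_right blinfun.scaleR_right)
  have lw: "blinfun_apply l w - blinfun_apply k0 w = F k0"
    unfolding w F_def sum_subtractf[symmetric]
    by (intro sum.cong) (auto simp: power2_eq_square algebra_simps)
  show thesis
  proof (rule that[of w])
    fix k assume k: "k \<in> C"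
    define B where "B = blinfun_apply k w - blinfun_apply k0 w"
    define G where "G = (\<Sum>v\<in>V. (blinfun_apply k v - blinfun_apply k0 v)\<^sup>2)"
    have G: "G \<le> M"
      unfolding G_def M_def
    proof (intro sum_mono)
      fix v
      have "\<bar>blinfun_apply k v - blinfun_apply k0 v\<bar> = norm (blinfun_apply (k - k0) v)"
        by (simp add: blinfun.diff_left)
      also have "\<dots> \<le> norm (k - k0) * norm v" by (rule norm_blinfun)
      also have "\<dots> \<le> (2 * R) * norm v"
        using R[OF k] R[OF k0(1)] norm_triangle_ineq4[of k k0] by (intro mult_right_mono) auto
      finally show "(blinfun_apply k v - blinfun_apply k0 v)\<^sup>2 \<le> (2 * R * norm v)\<^sup>2"
        using power_mono[of "\<bar>blinfun_apply k v - blinfun_apply k0 v\<bar>" _ 2] by simp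
    qed
    \<comment> \<open>Moving from \<open>k0\<close> towards \<open>k\<close> cannot bring
      \<open>F\<close> below \<open>m\<close>. Expanding in \<open>t\<close> yields
      \<open>B < 3 * m / 4\<close>, while \<open>l\<close> exceeds \<open>k0\<close> at
      \<open>w\<close> by \<open>F k0\<close>, which is at least \<open>m\<close>.\<close>
    have "(1 - t) *\<^sub>R k0 + t *\<^sub>R k \<in> C"
      using convexD_alt[OF \<open>convex C\<close> k0(1) k, of t] t by simp
    then have "m \<le> F ((1 - t) *\<^sub>R k0 + t *\<^sub>R k)" by (rule m_le)
    also have "\<dots> = F k0 - 2 * t * B + t\<^sup>2 * G"
      unfolding F_def B_def G_def w sum_subtractf[symmetric] sum_distrib_left sum.distrib[symmetric]
      by (intro sum.cong refl, unfold blinfun.add_left blinfun.scaleR_left real_scaleR_def)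
        algebra
    also have "\<dots> \<le> F k0 - 2 * t * B + t\<^sup>2 * M" using G by (simp add: mult_left_mono)
    also have "\<dots> \<le> F k0 - 2 * t * B + t * m"
      using mult_left_mono[OF t(3), of t] t(1) by (simp add: power2_eq_square mult.assoc)
    also have "\<dots> < m + t * m / 2 - 2 * t * B + t * m" using k0(2) by linarith
    finally have "t * (2 * B) < t * (3 * m / 2)" by (simp add: algebra_simps)
    then have "B < m" using t(1) m by simp
    then show "blinfun_apply k w < blinfun_apply l w"
      using lw m_le[OF k0(1)] by (simp add: B_def)
  qed
qed

section \<open>Weak* sequential compactness of bounded sequences of functionals\<close>

text \<open>The domain is only a normed space, so boundedness of the linear limit comes from the
  uniform bound \<open>R\<close>, not from Banach-Steinhaus.\<close>

lemma blinfun_of_pointwise_limit: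
  fixes f :: "nat \<Rightarrow> 'a::real_normed_vector \<Rightarrow>\<^sub>L 'b::real_normed_vector"
  assumes lim: "\<And>v. (\<lambda>n. blinfun_apply (f n) v) \<longlonglongrightarrow> g v" and R: "\<And>n. norm (f n) \<le> R"
  obtains k where "blinfun_apply k = g"
proof -
  have "bounded_linear g"
  proof (rule bounded_linear_intro)
    fix x y r
    show "g (x + y) = g x + g y"
      using tendsto_add[OF lim[of x] lim[of y]] lim[of "x + y"]
      by (simp add: blinfun.add_right LIMSEQ_unique)
    show "g (r *\<^sub>R x) = r *\<^sub>R g x"
      using tendsto_scaleR[OF tendsto_const lim[of x], of r] lim[of "r *\<^sub>R x"]
      by (simp add: blinfun.scaleR_right LIMSEQ_unique)
    have "norm (blinfun_apply (f n) x) \<le> norm x * R" for n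
      using norm_blinfun[of "f n" x] mult_right_mono[OF R[of n], of "norm x"]
      by (simp add: mult.commute)
    then show "norm (g x) \<le> norm x * R"
      using tendsto_norm[OF lim[of x]] by (intro LIMSEQ_le_const2) auto
  qed
  then show thesis using that bounded_linear_Blinfun_apply by blast
qed

text \<open>Sequential Banach-Alaoglu. The values on a countable dense set lie in a countable
  product of compact intervals, which is sequentially compact; the uniform norm bound then spreads
  convergence to all vectors.\<close>

lemma bounded_imp_weak_star_convergent_subsequence:
  fixes f :: "nat \<Rightarrow> 'a::real_normed_vector \<Rightarrow>\<^sub>L real"
  assumes sep: "separable_space (euclidean :: 'a topology)" and R: "\<And>n. norm (f n) \<le> R"
  obtains r k where "strict_mono (r :: nat \<Rightarrow> nat)"
    "limitin weak_star_topology (f \<circ> r) k sequentially"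
proof -
  obtain D :: "'a set" where D: "countable D" "closure D = UNIV"
    using sep by (auto simp: separable_space_def)
  then have "D \<noteq> {}" by auto
  \<comment> \<open>Enumerating \<open>D\<close> makes the coordinates range over
    \<open>nat\<close>, so the product is first countable and compactness gives convergent
    subsequences.\<close>
  define d where "d = from_nat_into D"
  have range_d: "range d = D"
    using D(1) \<open>D \<noteq> {}\<close> by (simp add: d_def range_from_nat_into)
  define S where "S = Pi\<^sub>E UNIV (\<lambda>i. {- (R * norm (d i))..R * norm (d i)})"
  define a where "a n i = blinfun_apply (f n) (d i)" for n i
  have bd: "\<bar>blinfun_apply (f n) v\<bar> \<le> R * norm v" for n v
    using norm_blinfun[of "f n" v] mult_right_mono[OF R[of n], of "norm v"] by simp
  have "compactin (product_topology (\<lambda>_. euclidean) UNIV) S"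
    unfolding S_def by (subst compactin_PiE) auto
  then have "compact S" by (simp add: euclidean_product_topology)
  moreover have "\<forall>n. a n \<in> S"
    using bd by (auto simp: S_def a_def abs_le_iff minus_le_iff)
  ultimately obtain b r where r: "strict_mono (r :: nat \<Rightarrow> nat)" "(a \<circ> r) \<longlonglongrightarrow> b"
    by (meson compact_imp_seq_compact seq_compactE)
  have "limitin (product_topology (\<lambda>_. euclidean) UNIV) (a \<circ> r) b sequentially"
    using r(2) by (simp add: euclidean_product_topology)
  then have lim_d: "(\<lambda>n. blinfun_apply (f (r n)) (d i)) \<longlonglongrightarrow> b i" for i
    by (simp add: limitin_componentwise a_def)
  have R0: "R \<ge> 0" using R[of 0] norm_ge_zero order_trans by blast
  have "Cauchy (\<lambda>n. blinfun_apply (f (r n)) v)" for v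
  proof (rule metric_CauchyI)
    fix e :: real assume e: "e > 0"
    have "v \<in> closure D" using D(2) by simp
    \<comment> \<open>\<open>R + 1\<close> replaces \<open>R\<close> to avoid dividing by
      zero.\<close>
    moreover have "e / (3 * (R + 1)) > 0" using e R0 by simp
    ultimately obtain i where i: "dist (d i) v < e / (3 * (R + 1))"
      using range_d unfolding closure_approachable by (metis rangeE)
    have "R * norm (v - d i) \<le> (R + 1) * norm (v - d i)" by (simp add: mult_right_mono)
    also have "\<dots> < e / 3"
      using i R0 by (simp add: dist_norm norm_minus_commute field_simps)
    finally have close: "\<bar>blinfun_apply (f n) v - blinfun_apply (f n) (d i)\<bar> < e / 3" for n
      using bd[of n "v - d i"] by (simp add: blinfun.diff_right)
    have "Cauchy (\<lambda>n. blinfun_apply (f (r n)) (d i))" using lim_d LIMSEQ_imp_Cauchy by blast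
    then obtain N where N: "\<And>p q. p \<ge> N \<Longrightarrow> q \<ge> N \<Longrightarrow>
        dist (blinfun_apply (f (r p)) (d i)) (blinfun_apply (f (r q)) (d i)) < e / 3"
      using metric_CauchyD[of _ "e / 3"] e by fastforce
    have "dist (blinfun_apply (f (r p)) v) (blinfun_apply (f (r q)) v) < e"
      if "p \<ge> N" "q \<ge> N" for p q
      using N[OF that] close[of "r p"] close[of "r q"] unfolding dist_real_def by argo
    then show "\<exists>N. \<forall>p\<ge>N. \<forall>q\<ge>N.
        dist (blinfun_apply (f (r p)) v) (blinfun_apply (f (r q)) v) < e" by blast
  qed
  then have "\<exists>g. \<forall>v. (\<lambda>n. blinfun_apply (f (r n)) v) \<longlonglongrightarrow> g v"
    by (intro choice) (simp add: Cauchy_convergent_iff convergent_def)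
  then obtain g where g: "\<And>v. (\<lambda>n. blinfun_apply (f (r n)) v) \<longlonglongrightarrow> g v" by blast
  obtain k where "blinfun_apply k = g"
    by (rule blinfun_of_pointwise_limit[where f = "f \<circ> r" and R = R]) (use g R in auto)
  then show thesis
    using that[OF r(1), of k] g by (simp add: limitin_strong_operator_topology)
qed

section \<open>Subgradients and the subdifferential\<close>

lemma fenchel_subgradientD:
  "fenchel_subgradient h x l \<Longrightarrow> h x + blinfun_apply l v \<le> h (x + v)"
  by (simp add: fenchel_subgradient_def)

lemma the_subgradient_works:
  "x \<in> unique_subgradient_points h \<Longrightarrow> fenchel_subgradient h x (the_subgradient h x)"
  unfolding unique_subgradient_points_def the_subgradient_def by (auto intro: theI')

text \<open>The Lipschitz bound on the increments of \<open>h\<close> bounds \<open>l\<close> from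
  above in every direction; the directions \<open>v\<close> and \<open>- v\<close> together bound
  its absolute value.\<close>

lemma fenchel_subgradient_norm_le:
  fixes h :: "'a::real_normed_vector \<Rightarrow> real"
  assumes L: "L-lipschitz_on UNIV h" and l: "fenchel_subgradient h x l"
  shows "norm l \<le> L"
proof (rule norm_blinfun_bound)
  show "0 \<le> L" by (rule lipschitz_on_nonneg[OF L])
  fix v
  have "blinfun_apply l u \<le> L * norm u" for u
    using fenchel_subgradientD[OF l, of u] lipschitz_onD[OF L, of "x + u" x]
    by (simp add: dist_norm)
  from this[of v] this[of "- v"] show "norm (blinfun_apply l v) \<le> L * norm v"
    by (simp add: blinfun.minus_right abs_le_iff)
qed

lemma convex_fenchel_subdifferential: "convex (fenchel_subdifferential h x)"
proof (rule convexI)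
  fix k l and u v :: real
  assume kl: "k \<in> fenchel_subdifferential h x" "l \<in> fenchel_subdifferential h x"
    and uv: "0 \<le> u" "0 \<le> v" "u + v = 1"
  have "h x + blinfun_apply (u *\<^sub>R k + v *\<^sub>R l) y \<le> h (x + y)" for y
  proof -
    have "h x + blinfun_apply (u *\<^sub>R k + v *\<^sub>R l) y
        = u * (h x + blinfun_apply k y) + v * (h x + blinfun_apply l y)"
      using uv(3) by (simp add: blinfun.add_left blinfun.scaleR_left algebra_simps
          flip: distrib_right)
    also have "\<dots> \<le> u * h (x + y) + v * h (x + y)"
      using kl uv by (intro add_mono mult_left_mono)
        (auto simp: fenchel_subdifferential_def fenchel_subgradient_def)
    also have "\<dots> = h (x + y)" using uv(3) by (simp flip: distrib_right)
    finally show ?thesis .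
  qed
  then show "u *\<^sub>R k + v *\<^sub>R l \<in> fenchel_subdifferential h x"
    by (simp add: fenchel_subdifferential_def fenchel_subgradient_def)
qed

text \<open>The subdifferential is an intersection of half-spaces, each the preimage of a closed ray
  under a weak* continuous evaluation.\<close>

lemma closedin_fenchel_subdifferential:
  "closedin weak_star_topology (fenchel_subdifferential h x)"
proof -
  have "closedin weak_star_topology {l. blinfun_apply l v \<in> {..h (x + v) - h x}}" for v
    using closedin_continuous_map_preimage[OF strong_operator_topology_continuous_evaluation,
        of "{..h (x + v) - h x}" v]
    by (simp add: strong_operator_topology_topspace)
  then have "closedin weak_star_topology
      (\<Inter>v. {l. blinfun_apply l v \<in> {..h (x + v) - h x}})"
    by (intro closedin_Inter) auto
  also have "(\<Inter>v. {l. blinfun_apply l v \<in> {..h (x + v) - h x}}) = fenchel_subdifferential h x"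
    by (auto simp: fenchel_subdifferential_def fenchel_subgradient_def algebra_simps)
  finally show ?thesis .
qed

section \<open>Net limits of unique subgradients\<close>

text \<open>For fixed \<open>v\<close>, both sides of the subgradient inequality at
  \<open>s i\<close> converge: continuity of \<open>h\<close> handles the moving base point, and
  weak* convergence the functional.\<close>

lemma net_limit_subgradients_subset:
  fixes h :: "'a::real_normed_vector \<Rightarrow> real"
  assumes "continuous_on UNIV h"
  shows "net_limit_subgradients h x \<subseteq> fenchel_subdifferential h x"
proof
  fix xs assume "xs \<in> net_limit_subgradients h x"
  then obtain I :: "('a set \<times> ('a \<Rightarrow>\<^sub>L real) set) set" and r s
    where "net_of_subgradients h x xs I r s"
    by (auto simp: net_limit_subgradients_def)
  then have dir: "directed_set I r" and Y: "\<And>i. i \<in> I \<Longrightarrow> s i \<in> unique_subgradient_points h"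
    and lim: "(s \<longlongrightarrow> x) (tails_filter I r)"
    and lim': "\<And>v. ((\<lambda>i. blinfun_apply (the_subgradient h (s i)) v) \<longlongrightarrow> blinfun_apply xs v)
      (tails_filter I r)"
    by (auto simp: net_of_subgradients_def limitin_strong_operator_topology)
  have h: "isCont h y" for y
    using assms by (simp add: continuous_on_eq_continuous_at)
  \<comment> \<open>By reflexivity each tail contains its own index, so no tail is empty.\<close>
  have nt: "tails_filter I r \<noteq> bot"
    using dir by (auto simp: trivial_limit_def eventually_tails_filter[OF dir] directed_set_def
        preorder_on_def refl_on_def)
  have ev: "eventually (\<lambda>i. i \<in> I) (tails_filter I r)"
    using dir by (auto simp: eventually_tails_filter[OF dir] directed_set_def)
  have "h x + blinfun_apply xs v \<le> h (x + v)" for v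
  proof (rule tendsto_le[OF nt])
    show "((\<lambda>i. h (s i + v)) \<longlongrightarrow> h (x + v)) (tails_filter I r)"
      by (intro isCont_tendsto_compose[OF h] tendsto_intros lim)
    show "((\<lambda>i. h (s i) + blinfun_apply (the_subgradient h (s i)) v) \<longlongrightarrow> h x + blinfun_apply xs v)
        (tails_filter I r)"
      by (intro isCont_tendsto_compose[OF h] tendsto_intros lim lim')
    show "\<forall>\<^sub>F i in tails_filter I r.
        h (s i) + blinfun_apply (the_subgradient h (s i)) v \<le> h (s i + v)"
      using ev by eventually_elim (auto intro: fenchel_subgradientD the_subgradient_works Y)
  qed
  then show "xs \<in> fenchel_subdifferential h x"
    by (simp add: fenchel_subdifferential_def fenchel_subgradient_def)
qed

text \<open>Sequences are nets over \<open>nat\<close>, which is not the index type fixed in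
  \<open>net_limit_subgradients\<close>; \<open>net_limit_subgradients_any_index\<close> bridges the
  gap.\<close>

lemma net_limit_subgradients_sequentially:
  fixes y :: "nat \<Rightarrow> 'a::real_normed_vector"
  assumes "\<And>n. y n \<in> unique_subgradient_points h" "y \<longlonglongrightarrow> x"
    and "limitin weak_star_topology (\<lambda>n. the_subgradient h (y n)) k sequentially"
  shows "k \<in> net_limit_subgradients h x"
proof -
  define r where "r = {(i, j :: nat). i \<le> j}"
  have dir: "directed_set (UNIV :: nat set) r"
    by (auto simp: directed_set_def preorder_on_def refl_on_def trans_def r_def
        intro: max.cobounded1 max.cobounded2)
  have "tails_filter UNIV r = sequentially"
    by (rule filter_eqI)
      (simp add: eventually_tails_filter[OF dir] eventually_sequentially, simp add: r_def)
  then have "net_of_subgradients h x k UNIV r y"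
    using assms dir by (simp add: net_of_subgradients_def)
  then show ?thesis by (rule net_limit_subgradients_any_index)
qed

text \<open>Density and separability enter here. The limit \<open>k\<close> may depend on
  \<open>v\<close>, which suffices because separation supplies a single direction.\<close>

lemma net_limit_subgradients_support:
  fixes h :: "'a::real_normed_vector \<Rightarrow> real"
  assumes sep: "separable_space (euclidean :: 'a topology)"
    and L: "L-lipschitz_on UNIV h"
    and dense: "closure (unique_subgradient_points h) = UNIV"
    and l: "fenchel_subgradient h x l"
  obtains k where "k \<in> net_limit_subgradients h x" "blinfun_apply l v \<le> blinfun_apply k v"
proof -
  define t where "t n = 1 / real (Suc n)" for n
  have t: "t n > 0" for n by (simp add: t_def)
  have t_lim: "t \<longlonglongrightarrow> 0" unfolding t_def by (rule LIMSEQ_Suc[OF lim_1_over_n])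
  \<comment> \<open>The tolerance is quadratic so that the approximation error still vanishes after
    division by \<open>t n\<close>.\<close>
  have "\<exists>y\<in>unique_subgradient_points h. dist y (x + t n *\<^sub>R v) < (t n)\<^sup>2" for n
    using dense t[of n] closure_approachable[of "x + t n *\<^sub>R v" "unique_subgradient_points h"]
    by simp
  then obtain y where y: "\<And>n. y n \<in> unique_subgradient_points h"
      "\<And>n. dist (y n) (x + t n *\<^sub>R v) < (t n)\<^sup>2"
    by metis
  define d where "d n = the_subgradient h (y n)" for n
  have d: "fenchel_subgradient h (y n) (d n)" for n
    using y(1) by (simp add: d_def the_subgradient_works)
  have y_lim: "y \<longlonglongrightarrow> x"
  proof -
    have "(\<lambda>n. x + t n *\<^sub>R v) \<longlonglongrightarrow> x + 0 *\<^sub>R v"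
      by (intro tendsto_intros t_lim)
    moreover have "(\<lambda>n. y n - (x + t n *\<^sub>R v)) \<longlonglongrightarrow> 0"
    proof (rule Lim_null_comparison)
      show "\<forall>\<^sub>F n in sequentially. norm (y n - (x + t n *\<^sub>R v)) \<le> (t n)\<^sup>2"
        using y(2) by (simp add: dist_norm less_imp_le)
      show "(\<lambda>n. (t n)\<^sup>2) \<longlonglongrightarrow> 0"
        using tendsto_power[OF t_lim, of 2] by simp
    qed
    ultimately show ?thesis using tendsto_add by fastforce
  qed
  have d_ge: "blinfun_apply l v - 2 * L * t n \<le> blinfun_apply (d n) v" for n
  proof -
    have "L * dist (y n) (x + t n *\<^sub>R v) \<le> L * (t n)\<^sup>2"
      using y(2)[of n] lipschitz_on_nonneg[OF L] by (intro mult_left_mono) auto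
    moreover have "dist (y n - t n *\<^sub>R v) x = dist (y n) (x + t n *\<^sub>R v)"
      by (simp add: dist_norm algebra_simps)
    ultimately have "\<bar>h (y n) - h (x + t n *\<^sub>R v)\<bar> \<le> L * (t n)\<^sup>2"
        "\<bar>h (y n - t n *\<^sub>R v) - h x\<bar> \<le> L * (t n)\<^sup>2"
      using lipschitz_onD[OF L, of "y n" "x + t n *\<^sub>R v"]
        lipschitz_onD[OF L, of "y n - t n *\<^sub>R v" x] by (auto simp: dist_real_def)
    moreover have "h x + t n * blinfun_apply l v \<le> h (x + t n *\<^sub>R v)"
      using fenchel_subgradientD[OF l, of "t n *\<^sub>R v"] by (simp add: blinfun.scaleR_right)
    moreover have "h (y n) - t n * blinfun_apply (d n) v \<le> h (y n - t n *\<^sub>R v)"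
      using fenchel_subgradientD[OF d, of n "- (t n *\<^sub>R v)"]
      by (simp add: blinfun.scaleR_right blinfun.minus_right)
    \<comment> \<open>All values of \<open>h\<close> cancel; each of the two Lipschitz estimates
      contributes an error \<open>L * (t n)\<^sup>2\<close>.\<close>
    ultimately have "t n * (blinfun_apply l v - 2 * L * t n) \<le> t n * blinfun_apply (d n) v"
      by (simp add: abs_le_iff algebra_simps power2_eq_square)
    then show ?thesis using t[of n] by simp
  qed
  obtain r k where r: "strict_mono (r :: nat \<Rightarrow> nat)"
    and k: "limitin weak_star_topology (d \<circ> r) k sequentially"
    by (rule bounded_imp_weak_star_convergent_subsequence[OF sep, of d L])
      (use fenchel_subgradient_norm_le[OF L d] in auto)
  show thesis
  proof (rule that)
    show "k \<in> net_limit_subgradients h x"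
    proof (rule net_limit_subgradients_sequentially)
      show "(y \<circ> r) n \<in> unique_subgradient_points h" for n using y(1) by simp
      show "(y \<circ> r) \<longlonglongrightarrow> x" by (rule LIMSEQ_subseq_LIMSEQ[OF y_lim r])
      show "limitin weak_star_topology (\<lambda>n. the_subgradient h ((y \<circ> r) n)) k sequentially"
        using k by (simp add: d_def o_def)
    qed
    have "(\<lambda>n. blinfun_apply l v - 2 * L * (t \<circ> r) n) \<longlonglongrightarrow> blinfun_apply l v - 2 * L * 0"
      by (intro tendsto_intros LIMSEQ_subseq_LIMSEQ[OF t_lim r])
    moreover have "(\<lambda>n. blinfun_apply (d (r n)) v) \<longlonglongrightarrow> blinfun_apply k v"
      using k by (simp add: limitin_strong_operator_topology)
    ultimately show "blinfun_apply l v \<le> blinfun_apply k v"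
      using d_ge by (intro LIMSEQ_le) auto
  qed
qed

section \<open>The subdifferential as a weak* closed convex hull\<close>

theorem corollary1p10:
  fixes h :: "'a::banach \<Rightarrow> real"
  assumes "separable_space (euclidean :: 'a topology)"
    and "convex_on UNIV h"
    and "\<exists>L. L-lipschitz_on UNIV h"
    and "closure (unique_subgradient_points h) = UNIV"
  shows "\<forall>x. fenchel_subdifferential h x =
           weak_star_topology closure_of (convex hull (net_limit_subgradients h x))"
proof
  fix x
  let ?C = "convex hull (net_limit_subgradients h x)"
  obtain L where L: "L-lipschitz_on UNIV h" using assms(3) by blast
  have sub: "?C \<subseteq> fenchel_subdifferential h x"
    by (intro hull_minimal net_limit_subgradients_subset convex_fenchel_subdifferential
        lipschitz_on_continuous_on[OF L])
  have "bounded (fenchel_subdifferential h x)"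
    using fenchel_subgradient_norm_le[OF L] by (auto simp: bounded_iff fenchel_subdifferential_def)
  then have bounded: "bounded ?C" using sub by (rule bounded_subset)
  show "fenchel_subdifferential h x = weak_star_topology closure_of ?C"
  proof (intro antisym subsetI)
    fix l assume "l \<in> fenchel_subdifferential h x"
    then have l: "fenchel_subgradient h x l" by (simp add: fenchel_subdifferential_def)
    show "l \<in> weak_star_topology closure_of ?C"
    proof (rule ccontr)
      assume "l \<notin> weak_star_topology closure_of ?C"
      then obtain v where v: "\<And>k. k \<in> ?C \<Longrightarrow> blinfun_apply k v < blinfun_apply l v"
        using weak_star_separation[OF convex_convex_hull bounded] by blast
      obtain k where "k \<in> net_limit_subgradients h x" "blinfun_apply l v \<le> blinfun_apply k v"
        using net_limit_subgradients_support[OF assms(1) L assms(4) l] by blast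
      then show False using v[OF hull_inc] by fastforce
    qed
  next
    fix l assume "l \<in> weak_star_topology closure_of ?C"
    then show "l \<in> fenchel_subdifferential h x"
      using closure_of_minimal[OF sub closedin_fenchel_subdifferential] by blast
  qed
qed

end
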